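(* $2$-WL has stronger link discriminating power than $1$-WL. That is: (i) for all finite undirected node-labeled graphs $G=(V,E,l)$, $G'=(V',E',l')$ and all target links $e\in V\times V$, $e'\in V'\times V'$, if $1$-WL distinguishes $(e,G)$ and $(e',G')$, then $2$-WL distinguishes $(e,G)$ and $(e',G')$; and (ii) there exist graphs $G_1,G_1'$ and target links $e_1,e_1'$ in them such that $2$-WL distinguishes $(e_1,G_1)$ and $(e_1',G_1')$ but $1$-WL does not.
   Context: Graphs. A labeled graph is $G=(V,E,l)$ with finite node set $V=[n]=\{1,\dots,n\}$, edge set $E\subseteq V\times V$ (undirected, i.e. $E$ is symmetric), and $l:V\to\Sigma$ a node labeling in a label set $\Sigma$. $N(v)$ denotes the set of neighbors of $v$. A link is an ordered pair $e=(p,q)\in V\times V$. Multisets are written $\{\!\!\{\cdot\}\!\!\}$. Standing assumption. The target links being compared have unknown edge status: their edge-existence indicator is set to $0$, i.e. target links $e=(p,q)$ in $G$ and $e'=(p',q')$ in $G'$ satisfy $e\notin E$, $e'\notin E'$ (the target link is not part of the observed graph). $1$-WL. $c^{(0)}(v)=l(v)$ and $c^{(t)}(v)=f\big(c^{(t-1)}(v),\{\!\!\{c^{(t-1)}(u): u\in N(v)\}\!\!\}\big)$ for $t\ge 1$, with $f$ a fixed injective function (the same for all graphs). $1$-WL distinguishes $(e,G)$ and $(e',G')$, where $e=(p,q)$, $e'=(p',q')$, unless $c^{(t)}(p)=c^{(t)}(p')$ and $c^{(t)}(q)=c^{(t)}(q')$ for all $t\ge 0$. $2$-WL. Colors are assigned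 to all pairs in $V\times V$: $c^{(0)}(p,q)=\big(l(p),l(q),\mathbf 1[(p,q)\in E]\big)$ and, for $t\ge1$, $$c^{(t)}(p,q)=f\Big(c^{(t-1)}(p,q),\ \{\!\!\{c^{(t-1)}(u,q): u\in V\}\!\!\},\ \{\!\!\{c^{(t-1)}(p,v): v\in V\}\!\!\}\Big),$$ with $f$ a fixed injective function (the same for all graphs). $2$-WL distinguishes $(e,G)$ and $(e',G')$ unless $c^{(t)}(e)=c^{(t)}(e')$ for all $t\ge0$. *)

theory Defs
  imports Main "HOL-Library.Multiset"
begin

text \<open>
  The node set is \<open>{1..order G}\<close> and \<open>label G\<close> is only meaningful there. Edges are ordered pairs;
  undirectedness is symmetry of the edge set, and self-loops are not excluded.
\<close>

record 'l graph =
  order :: nat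
  edges :: "(nat \<times> nat) set"
  label :: "nat \<Rightarrow> 'l"

definition nodes :: "'l graph \<Rightarrow> nat set" where
  "nodes G = {1..order G}"

definition labeled_graph :: "'l graph \<Rightarrow> bool" where
  "labeled_graph G \<longleftrightarrow> edges G \<subseteq> nodes G \<times> nodes G \<and> sym (edges G)"

definition neighbors :: "'l graph \<Rightarrow> nat \<Rightarrow> nat set" where
  "neighbors G v = {u. (v, u) \<in> edges G}"

text \<open>The edge status of a target link is unknown, hence it is not part of the observed graph.\<close>

definition target_link :: "'l graph \<Rightarrow> nat \<times> nat \<Rightarrow> bool" where
  "target_link G e \<longleftrightarrow> e \<in> nodes G \<times> nodes G \<and> e \<notin> edges G"

text \<open>
  Colors live in an arbitrary type. The parameter \<open>\<iota>\<close>, to be taken injective, regards initial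
  colors (labels for 1-WL, triples for 2-WL) as elements of that type; \<open>f\<close> is the injective
  update function. Both are shared by all graphs. The color type must be infinite for an injective
  \<open>f\<close> to exist, so it is kept separate from the label type, which may be finite.
\<close>

primrec wl1 :: "('l \<Rightarrow> 'c) \<Rightarrow> ('c \<times> 'c multiset \<Rightarrow> 'c) \<Rightarrow> 'l graph \<Rightarrow> nat \<Rightarrow> nat \<Rightarrow> 'c" where
  "wl1 \<iota> f G 0 v = \<iota> (label G v)"
| "wl1 \<iota> f G (Suc t) v = f (wl1 \<iota> f G t v, {#wl1 \<iota> f G t u. u \<in># mset_set (neighbors G v)#})"

primrec wl2 :: "('l \<times> 'l \<times> bool \<Rightarrow> 'c) \<Rightarrow> ('c \<times> 'c multiset \<times> 'c multiset \<Rightarrow> 'c)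
    \<Rightarrow> 'l graph \<Rightarrow> nat \<Rightarrow> nat \<times> nat \<Rightarrow> 'c" where
  "wl2 \<iota> f G 0 e = \<iota> (label G (fst e), label G (snd e), e \<in> edges G)"
| "wl2 \<iota> f G (Suc t) e =
     f (wl2 \<iota> f G t e,
        {#wl2 \<iota> f G t (u, snd e). u \<in># mset_set (nodes G)#},
        {#wl2 \<iota> f G t (fst e, v). v \<in># mset_set (nodes G)#})"

definition wl1_distinguishes ::
  "('l \<Rightarrow> 'c) \<Rightarrow> ('c \<times> 'c multiset \<Rightarrow> 'c) \<Rightarrow> 'l graph \<Rightarrow> nat \<times> nat \<Rightarrow> 'l graph \<Rightarrow> nat \<times> nat \<Rightarrow> bool"
where
  "wl1_distinguishes \<iota> f G e G' e' \<longleftrightarrow>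
     \<not> (\<forall>t. wl1 \<iota> f G t (fst e) = wl1 \<iota> f G' t (fst e') \<and>
             wl1 \<iota> f G t (snd e) = wl1 \<iota> f G' t (snd e'))"

definition wl2_distinguishes ::
  "('l \<times> 'l \<times> bool \<Rightarrow> 'c) \<Rightarrow> ('c \<times> 'c multiset \<times> 'c multiset \<Rightarrow> 'c)
    \<Rightarrow> 'l graph \<Rightarrow> nat \<times> nat \<Rightarrow> 'l graph \<Rightarrow> nat \<times> nat \<Rightarrow> bool"
where
  "wl2_distinguishes \<iota> f G e G' e' \<longleftrightarrow> \<not> (\<forall>t. wl2 \<iota> f G t e = wl2 \<iota> f G' t e')"

end

theory Submission
  imports Defs
begin

text \<open>
  For (i), a 2-WL color of \<open>(p, q)\<close> at step \<open>t\<close> can be decoded, by a function independent of the graph,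
  into the 1-WL colors of \<open>p\<close> and \<open>q\<close> at step \<open>t\<close> and the adjacency bit: the colors of the
  neighbors of \<open>q\<close> are read off the multiset of colors of \<open>(u, q)\<close> by keeping those whose bit is set,
  and similarly for \<open>p\<close>.
  For (ii), in an edgeless graph 1-WL sees only the labels, whereas 2-WL counts all nodes, so
  edgeless graphs with 2 and 3 equally labeled nodes suffice.
\<close>

text \<open>The graph is not an argument, so equal 2-WL colors decode equally even when they come
  from different graphs. \<open>inv\<close> is meaningful because it is only used on values of the
  injective \<open>\<iota>2\<close> and \<open>f2\<close>. \<open>N\<close> comes from pairs
  \<open>(p, v)\<close> and so serves \<open>p\<close>; \<open>M\<close> comes from pairs
  \<open>(u, q)\<close> and serves \<open>q\<close>.\<close>

primrec decode :: "('l \<Rightarrow> 'c) \<Rightarrow> ('c \<times> 'c multiset \<Rightarrow> 'c) \<Rightarrow> ('l \<times> 'l \<times> bool \<Rightarrow> 'd) \<Rightarrow>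
    ('d \<times> 'd multiset \<times> 'd multiset \<Rightarrow> 'd) \<Rightarrow> nat \<Rightarrow> 'd \<Rightarrow> 'c \<times> 'c \<times> bool" where
  "decode \<iota>1 f1 \<iota>2 f2 0 c = (case inv \<iota>2 c of (a, b, adj) \<Rightarrow> (\<iota>1 a, \<iota>1 b, adj))"
| "decode \<iota>1 f1 \<iota>2 f2 (Suc t) c =
    (case inv f2 c of (c', M, N) \<Rightarrow>
      (case decode \<iota>1 f1 \<iota>2 f2 t c' of (x, y, adj) \<Rightarrow>
        (f1 (x, {#fst (snd z). z \<in># filter_mset (snd \<circ> snd) (image_mset (decode \<iota>1 f1 \<iota>2 f2 t) N)#}),
         f1 (y, {#fst z. z \<in># filter_mset (snd \<circ> snd) (image_mset (decode \<iota>1 f1 \<iota>2 f2 t) M)#}),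
         adj)))"

lemma neighbors_eq_out:
  assumes "labeled_graph G"
  shows "neighbors G v = {u \<in> nodes G. (v, u) \<in> edges G}"
  using assms by (auto simp: labeled_graph_def neighbors_def)

text \<open>The bit of \<open>(u, q)\<close> records an edge into \<open>q\<close>, whereas
  \<open>neighbors\<close> follows outgoing edges; symmetry reconciles the two.\<close>

lemma neighbors_eq_in:
  assumes "labeled_graph G"
  shows "neighbors G v = {u \<in> nodes G. (u, v) \<in> edges G}"
  using assms by (auto simp: labeled_graph_def neighbors_def dest: symD)

lemma finite_nodes [simp]: "finite (nodes G)"
  by (simp add: nodes_def)

text \<open>Induction on \<open>t\<close> with \<open>p\<close> and \<open>q\<close> arbitrary,
  since one update involves all pairs \<open>(u, q)\<close> and \<open>(p, v)\<close>. The adjacency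
  bit is fixed at step 0 and handed down unchanged.\<close>

lemma decode_wl2:
  assumes G: "labeled_graph G" and inj: "inj \<iota>2" "inj f2"
  shows "decode \<iota>1 f1 \<iota>2 f2 t (wl2 \<iota>2 f2 G t (p, q)) =
    (wl1 \<iota>1 f1 G t p, wl1 \<iota>1 f1 G t q, (p, q) \<in> edges G)"
proof (induction t arbitrary: p q)
  case 0
  then show ?case
    using inj by simp
next
  case (Suc t)
  \<comment> \<open>By the induction hypothesis the filter tests
    \<open>(p, v) \<in> edges G\<close>, which cuts \<open>nodes G\<close> down to the neighbors of
    \<open>p\<close>.\<close>
  have "{#wl1 \<iota>1 f1 G t u. u \<in># mset_set (neighbors G p)#} =
      {#fst (snd z). z \<in># filter_mset (snd \<circ> snd)
        {#decode \<iota>1 f1 \<iota>2 f2 t (wl2 \<iota>2 f2 G t (p, v)). v \<in># mset_set (nodes G)#}#}"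
    by (simp add: Suc.IH neighbors_eq_out [OF G] filter_mset_image_mset multiset.map_comp comp_def
        flip: filter_mset_mset_set)
  moreover have "{#wl1 \<iota>1 f1 G t u. u \<in># mset_set (neighbors G q)#} =
      {#fst z. z \<in># filter_mset (snd \<circ> snd)
        {#decode \<iota>1 f1 \<iota>2 f2 t (wl2 \<iota>2 f2 G t (u, q)). u \<in># mset_set (nodes G)#}#}"
    by (simp add: Suc.IH neighbors_eq_in [OF G] filter_mset_image_mset multiset.map_comp comp_def
        flip: filter_mset_mset_set)
  ultimately show ?case
    using inj by (simp add: Suc.IH multiset.map_comp comp_def)
qed

lemma wl2_distinguishes_if_wl1_distinguishes:
  assumes "labeled_graph G" "labeled_graph G'" "inj \<iota>2" "inj f2"
    and "wl1_distinguishes \<iota>1 f1 G e G' e'"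
  shows "wl2_distinguishes \<iota>2 f2 G e G' e'"
proof -
  obtain p q p' q' where e: "e = (p, q)" "e' = (p', q')"
    by (metis surj_pair)
  have "wl1 \<iota>1 f1 G t p = wl1 \<iota>1 f1 G' t p' \<and> wl1 \<iota>1 f1 G t q = wl1 \<iota>1 f1 G' t q'"
    if "wl2 \<iota>2 f2 G t e = wl2 \<iota>2 f2 G' t e'" for t
    \<comment> \<open>Apply the same decoder to both sides of the equal 2-WL colors.\<close>
    using that decode_wl2 [of G \<iota>2 f2 \<iota>1 f1 t p q] decode_wl2 [of G' \<iota>2 f2 \<iota>1 f1 t p' q'] assms(1-4)
    by (simp add: e)
  then show ?thesis
    using assms(5) by (auto simp: wl1_distinguishes_def wl2_distinguishes_def e)
qed

lemma wl1_edgeless_cong: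
  assumes "edges G = {}" "edges G' = {}" "label G v = label G' v'"
  shows "wl1 \<iota> f G t v = wl1 \<iota> f G' t v'"
  using assms by (induction t) (simp_all add: neighbors_def)

text \<open>One update suffices: its first multiset has one entry per node, so its size is the
  order, whatever the colors are.\<close>

lemma wl2_distinguishes_if_order_neq:
  assumes "inj f" "order G \<noteq> order G'"
  shows "wl2_distinguishes \<iota> f G e G' e'"
proof -
  have "wl2 \<iota> f G (Suc 0) e \<noteq> wl2 \<iota> f G' (Suc 0) e'"
  proof
    assume "wl2 \<iota> f G (Suc 0) e = wl2 \<iota> f G' (Suc 0) e'"
    then have "{#wl2 \<iota> f G 0 (u, snd e). u \<in># mset_set (nodes G)#} =
        {#wl2 \<iota> f G' 0 (u, snd e'). u \<in># mset_set (nodes G')#}"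
      using assms(1) by (simp add: inj_eq)
    then have "size (mset_set (nodes G)) = size (mset_set (nodes G'))"
      by (metis size_image_mset)
    then show False
      using assms(2) by (simp add: nodes_def)
  qed
  then show ?thesis
    unfolding wl2_distinguishes_def by blast
qed

theorem theorem4p1:
  fixes \<iota>1 :: "'l \<Rightarrow> 'c" and f1 :: "'c \<times> 'c multiset \<Rightarrow> 'c"
    and \<iota>2 :: "'l \<times> 'l \<times> bool \<Rightarrow> 'd" and f2 :: "'d \<times> 'd multiset \<times> 'd multiset \<Rightarrow> 'd"
  assumes "inj \<iota>1" and "inj f1" and "inj \<iota>2" and "inj f2"
  shows "(\<forall>(G :: 'l graph) (G' :: 'l graph) e e'.
            labeled_graph G \<and> labeled_graph G' \<and> target_link G e \<and> target_link G' e' \<longrightarrow>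
            wl1_distinguishes \<iota>1 f1 G e G' e' \<longrightarrow> wl2_distinguishes \<iota>2 f2 G e G' e')
       \<and> (\<exists>(G :: 'l graph) (G' :: 'l graph) e e'.
            labeled_graph G \<and> labeled_graph G' \<and> target_link G e \<and> target_link G' e' \<and>
            wl2_distinguishes \<iota>2 f2 G e G' e' \<and> \<not> wl1_distinguishes \<iota>1 f1 G e G' e')"
proof (intro conjI allI impI)
  fix G G' :: "'l graph" and e e'
  assume "labeled_graph G \<and> labeled_graph G' \<and> target_link G e \<and> target_link G' e'"
    and "wl1_distinguishes \<iota>1 f1 G e G' e'"
  then show "wl2_distinguishes \<iota>2 f2 G e G' e'"
    using assms wl2_distinguishes_if_wl1_distinguishes by blast
next
  \<comment> \<open>As \<open>'l\<close> is arbitrary, \<open>undefined\<close> merely supplies some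
    constant label.\<close>
  define E :: "nat \<Rightarrow> 'l graph" where "E n = \<lparr>order = n, edges = {}, label = \<lambda>_. undefined\<rparr>" for n
  have "labeled_graph (E n)" for n
    by (simp add: E_def labeled_graph_def sym_def)
  moreover have "target_link (E 2) (1, 2)" "target_link (E 3) (1, 2)"
    by (simp_all add: E_def target_link_def nodes_def)
  moreover have "wl2_distinguishes \<iota>2 f2 (E 2) (1, 2) (E 3) (1, 2)"
    using assms by (intro wl2_distinguishes_if_order_neq) (simp_all add: E_def)
  moreover have "\<not> wl1_distinguishes \<iota>1 f1 (E 2) (1, 2) (E 3) (1, 2)"
    unfolding wl1_distinguishes_def
    by (auto intro!: wl1_edgeless_cong simp: E_def)
  ultimately show "\<exists>(G :: 'l graph) (G' :: 'l graph) e e'.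
            labeled_graph G \<and> labeled_graph G' \<and> target_link G e \<and> target_link G' e' \<and>
            wl2_distinguishes \<iota>2 f2 G e G' e' \<and> \<not> wl1_distinguishes \<iota>1 f1 G e G' e'"
    by blast
qed

end
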